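(* Suppose $\epsilon=0$. Then adding to $P$ the inequalities $$\sum_{i\in S}y_i+\sum_{i\in\bar S}\big(D_{t_{\ell(1)}}-D_{t_{i-1(1)}}\big)x_i+\sum_{j\in\bar T}\bar\alpha_jz_j\ \ge\ D_{t_{\ell(1)}}$$ (for all $\ell\in N$, all $S\subseteq[\ell]$ with $\bar S=[\ell]\setminus S$, and all choices of the sets $T_{i-1}$, $i\in(\bar S\setminus\{1\})\cup\{\ell+1\}$, described in the context) is sufficient to give the complete linear description of $\mathrm{conv}(P)$. That is, $\mathrm{conv}(P)$ equals the set of points of the linear programming relaxation of $P$ that satisfy all these inequalities.
   Context: For a positive integer $r$, $[r]=\{1,\dots,r\}$. $N=\{1,\dots,n\}$ is the set of time periods and $\Omega=\{1,\dots,m\}$ is the set of scenarios, all with probability $1/m$. $d_{ji}\ge0$ is the demand in period $i$ under scenario $j$; $0\le\epsilon<1$ is a given risk level and $k=\lfloor m\epsilon\rfloor$ (so $k=0$ when $\epsilon=0$). $M_i=\max_{j\in\Omega}\sum_{p=i}^n d_{jp}$ for $i\in N$. The set $P$ is the set of all $(\mathbf x,\mathbf y,\mathbf z)\in\{0,1\}^n\times\mathbb R_+^n\times\{0,1\}^m$ satisfying $\sum_{i=1}^t y_i\ge\sum_{i=1}^t d_{ji}(1-z_j)$ for all $t\in N,\ j\in\Omega$; $\ \sum_{j=1}^m z_j\le k$; $\ y_i\le M_ix_i$ for all $i\in N$. Its linear programming relaxation is obtained by replacing $\{0,1\}^n$ and $\{0,1\}^m$ by $[0,1]^n$ and $[0,1]^m$.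 Cumulative demands: $D_{ji}=\sum_{p=1}^i d_{jp}$. For each $i\in N$, $\sigma_{i(1)},\dots,\sigma_{i(m)}$ is a fixed ordering of the scenarios with $D_{\sigma_{i(1)}i}\ge\cdots\ge D_{\sigma_{i(m)}i}$, and $T_i^*=\{\sigma_{i(1)},\dots,\sigma_{i(k)}\}$ (empty when $k=0$). For scenarios written as $\sigma_{i(p)}$ or $t_{i(p)}$ the period index is dropped: $D_{\sigma_{i(p)}}=D_{\sigma_{i(p)}i}$, $D_{t_{i(p)}}=D_{t_{i(p)}i}$. Data of the inequalities: for every $i\in(\bar S\setminus\{1\})\cup\{\ell+1\}$, $T_{i-1}=\{t_{i-1(1)},\dots,t_{i-1(a_{i-1})}\}\subseteq T^*_{i-1}$ with $D_{t_{i-1(1)}}\ge\cdots\ge D_{t_{i-1(a_{i-1})}}$ and $t_{i-1(a_{i-1}+1)}=\sigma_{i-1(k+1)}$ (so $t_{i-1(1)}=\sigma_{i-1(k+1)}$ if $T_{i-1}=\emptyset$); $t_{\ell(1)}=\sigma_{\ell(1)}$ is fixed; $\bar T=(\bigcup_{i\in\bar S}T_{i-1})\cup T_\ell$. For $j\in\bar T$ and $i$ with $i=\ell$ or $i+1\in\bar S$, $\alpha_{ji}=0$ if $j\notin T_i$ and $\alpha_{ji}=D_{t_{i(p)}}-D_{t_{i(p+1)}}$ if $j=t_{i(p)}\in T_i$; $\bar\alpha_j=\max\{\max_{i\in\bar S}\{\alpha_{j(i-1)}\},\alpha_{j\ell}\}$. Convention for period $0$ (when $1\in\bar S$): $T_0=\emptyset$,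 $D_{t_{0(1)}}=0$, $\alpha_{j0}=0$. *)

theory Defs
  imports "HOL-Analysis.Analysis"
begin

text \<open>
  Scenarios are the elements of a finite type \<open>'m\<close>, so \<open>m = CARD('m)\<close>.  Periods are the
  natural numbers \<open>1, \<dots>, n\<close> with \<open>n = CARD('n)\<close>.  Vectors indexed by periods
  live in \<open>real ^ 'n\<close>; a bijection \<open>pd\<close> from \<open>{1..n}\<close> onto \<open>'n\<close> names their coordinates, so
  that \<open>y $ pd i\<close> is \<open>y\<^sub>i\<close>.  The demand in period \<open>i\<close> under scenario \<open>j\<close> is \<open>d j i\<close>.
\<close>

type_synonym ('n, 'm) point = "(real ^ 'n) \<times> (real ^ 'n) \<times> (real ^ 'm)"

definition cum_demand :: "('m \<Rightarrow> nat \<Rightarrow> real) \<Rightarrow> 'm \<Rightarrow> nat \<Rightarrow> real" where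
  "cum_demand d j i = (\<Sum>p = 1..i. d j p)"

definition big_M :: "('m::finite \<Rightarrow> nat \<Rightarrow> real) \<Rightarrow> nat \<Rightarrow> nat \<Rightarrow> real" where
  "big_M d n i = (MAX j. \<Sum>p = i..n. d j p)"

definition violations :: "nat \<Rightarrow> real \<Rightarrow> nat" where
  "violations m \<epsilon> = nat \<lfloor>real m * \<epsilon>\<rfloor>"

definition linear_constraints ::
  "(nat \<Rightarrow> 'n::finite) \<Rightarrow> ('m::finite \<Rightarrow> nat \<Rightarrow> real) \<Rightarrow> real
    \<Rightarrow> real ^ 'n \<Rightarrow> real ^ 'n \<Rightarrow> real ^ 'm \<Rightarrow> bool" where
  "linear_constraints pd d \<epsilon> x y z \<longleftrightarrow>
     (\<forall>t \<in> {1..CARD('n)}. \<forall>j. (\<Sum>i = 1..t. y $ pd i) \<ge> (\<Sum>i = 1..t. d j i * (1 - z $ j))) \<and>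
     (\<Sum>j\<in>UNIV. z $ j) \<le> real (violations CARD('m) \<epsilon>) \<and>
     (\<forall>i \<in> {1..CARD('n)}. y $ pd i \<le> big_M d CARD('n) i * x $ pd i)"

definition lot_sizing_set ::
  "(nat \<Rightarrow> 'n::finite) \<Rightarrow> ('m::finite \<Rightarrow> nat \<Rightarrow> real) \<Rightarrow> real \<Rightarrow> ('n, 'm) point set" where
  "lot_sizing_set pd d \<epsilon> =
     {(x, y, z). (\<forall>i. x $ i \<in> {0, 1}) \<and> (\<forall>i. y $ i \<ge> 0) \<and> (\<forall>j. z $ j \<in> {0, 1}) \<and>
        linear_constraints pd d \<epsilon> x y z}"

definition lp_relaxation ::
  "(nat \<Rightarrow> 'n::finite) \<Rightarrow> ('m::finite \<Rightarrow> nat \<Rightarrow> real) \<Rightarrow> real \<Rightarrow> ('n, 'm) point set" where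
  "lp_relaxation pd d \<epsilon> =
     {(x, y, z). (\<forall>i. x $ i \<in> {0..1}) \<and> (\<forall>i. y $ i \<ge> 0) \<and> (\<forall>j. z $ j \<in> {0..1}) \<and>
        linear_constraints pd d \<epsilon> x y z}"

definition scenario_ordering ::
  "('m::finite \<Rightarrow> nat \<Rightarrow> real) \<Rightarrow> nat \<Rightarrow> (nat \<Rightarrow> 'm) \<Rightarrow> bool" where
  "scenario_ordering d i s \<longleftrightarrow>
     bij_betw s {1..CARD('m)} UNIV \<and>
     (\<forall>p \<in> {1..CARD('m)}. \<forall>q \<in> {1..CARD('m)}.
        p \<le> q \<longrightarrow> cum_demand d (s q) i \<le> cum_demand d (s p) i)"

definition T_star :: "(nat \<Rightarrow> nat \<Rightarrow> 'm) \<Rightarrow> nat \<Rightarrow> nat \<Rightarrow> 'm set" where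
  "T_star \<sigma> k i = \<sigma> i ` {1..k}"

text \<open>
  A choice of sets \<open>T i\<close> comes with enumerations \<open>t i 1, \<dots>, t i (card (T i))\<close> by decreasing
  cumulative demand, extended by one further scenario.  Only the periods \<open>i - 1\<close> with
  \<open>i \<in> (S' - {1}) \<union> {l + 1}\<close> matter, where \<open>S'\<close> is the complement of \<open>S\<close> in \<open>{1..l}\<close>.
  For period \<open>0\<close> we require \<open>T 0 = {}\<close>; the other conventions for that period hold
  automatically, as \<open>cum_demand d j 0 = 0\<close>.
\<close>

definition admissible_choice ::
  "('m \<Rightarrow> nat \<Rightarrow> real) \<Rightarrow> (nat \<Rightarrow> nat \<Rightarrow> 'm) \<Rightarrow> nat \<Rightarrow> nat \<Rightarrow> nat set
    \<Rightarrow> (nat \<Rightarrow> 'm set) \<Rightarrow> (nat \<Rightarrow> nat \<Rightarrow> 'm) \<Rightarrow> bool" where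
  "admissible_choice d \<sigma> k l S T t \<longleftrightarrow>
     T 0 = {} \<and>
     (\<forall>i \<in> (({1..l} - S) - {1}) \<union> {l + 1}.
        T (i - 1) \<subseteq> T_star \<sigma> k (i - 1) \<and>
        bij_betw (t (i - 1)) {1..card (T (i - 1))} (T (i - 1)) \<and>
        (\<forall>p \<in> {1..card (T (i - 1))}. \<forall>q \<in> {1..card (T (i - 1))}. p \<le> q \<longrightarrow>
           cum_demand d (t (i - 1) q) (i - 1) \<le> cum_demand d (t (i - 1) p) (i - 1)) \<and>
        t (i - 1) (card (T (i - 1)) + 1) = \<sigma> (i - 1) (k + 1)) \<and>
     t l 1 = \<sigma> l 1"

definition alpha ::
  "('m \<Rightarrow> nat \<Rightarrow> real) \<Rightarrow> (nat \<Rightarrow> 'm set) \<Rightarrow> (nat \<Rightarrow> nat \<Rightarrow> 'm) \<Rightarrow> 'm \<Rightarrow> nat \<Rightarrow> real" where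
  "alpha d T t j i =
     (if j \<in> T i
      then let p = (THE p. p \<in> {1..card (T i)} \<and> t i p = j)
           in cum_demand d (t i p) i - cum_demand d (t i (p + 1)) i
      else 0)"

definition alpha_bar ::
  "('m \<Rightarrow> nat \<Rightarrow> real) \<Rightarrow> nat \<Rightarrow> nat set \<Rightarrow> (nat \<Rightarrow> 'm set) \<Rightarrow> (nat \<Rightarrow> nat \<Rightarrow> 'm) \<Rightarrow> 'm \<Rightarrow> real" where
  "alpha_bar d l S T t j =
     Max ((\<lambda>i. alpha d T t j (i - 1)) ` ({1..l} - S) \<union> {alpha d T t j l})"

definition T_bar :: "nat \<Rightarrow> nat set \<Rightarrow> (nat \<Rightarrow> 'm set) \<Rightarrow> 'm set" where
  "T_bar l S T = (\<Union>i \<in> {1..l} - S. T (i - 1)) \<union> T l"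

definition mixing_ineq ::
  "(nat \<Rightarrow> 'n::finite) \<Rightarrow> ('m::finite \<Rightarrow> nat \<Rightarrow> real) \<Rightarrow> nat \<Rightarrow> nat set
    \<Rightarrow> (nat \<Rightarrow> 'm set) \<Rightarrow> (nat \<Rightarrow> nat \<Rightarrow> 'm) \<Rightarrow> real ^ 'n \<Rightarrow> real ^ 'n \<Rightarrow> real ^ 'm \<Rightarrow> bool" where
  "mixing_ineq pd d l S T t x y z \<longleftrightarrow>
     (\<Sum>i\<in>S. y $ pd i)
     + (\<Sum>i\<in>{1..l} - S.
          (cum_demand d (t l 1) l - cum_demand d (t (i - 1) 1) (i - 1)) * x $ pd i)
     + (\<Sum>j\<in>T_bar l S T. alpha_bar d l S T t j * z $ j)
     \<ge> cum_demand d (t l 1) l"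

end

theory Submission
  imports Defs
begin

text \<open>
  For \<open>\<epsilon> = 0\<close> no scenario may be violated, so \<open>z = 0\<close> and only the largest cumulative demands
  \<open>D l\<close> matter: the inequalities become the \<open>(l, S)\<close> inequalities of deterministic uncapacitated
  lot-sizing. They cut out a compact convex set, which is the hull of its extreme points, so it
  suffices that these have \<open>x\<close> integral.

  Attach to period \<open>i\<close> the interval of weight \<open>x i\<close> that starts at \<open>s i = D (i - 1)\<close> and has
  length \<open>a i = y i / x i\<close>. The \<open>(l, S)\<close> inequalities say that the weighted length \<open>F v\<close> lying
  below \<open>v = D l\<close> is at least \<open>v\<close>. Between consecutive tight values of \<open>v\<close>, either some interval
  ends in the interior, and its \<open>y\<close> may be changed freely, or the intervals meeting the block
  cover it entirely and their weights sum to 1. Selecting intervals that cover every block of the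
  second kind exactly once and moving the fractional \<open>x\<close> towards this selection, with the \<open>y\<close>
  corrected in the blocks of the first kind, preserves all tight inequalities. Hence a point with
  fractional \<open>x\<close> is not extreme.
\<close>

section \<open>Weighted intervals: exact covers, endpoint corrections, tight blocks\<close>

lemma sum_pos_eq_1_imp_singleton:
  fixes x :: "'a \<Rightarrow> real"
  assumes "finite A" "\<And>i. i \<in> A \<Longrightarrow> x i > 0" "sum x A = 1" "i \<in> A" "x i = 1"
  shows "A = {i}"
proof (rule ccontr)
  assume "A \<noteq> {i}"
  then obtain k where "k \<in> A - {i}"
    using \<open>i \<in> A\<close> by blast
  then have "sum x (A - {i}) > 0"
    using assms(1,2) by (intro sum_pos) auto
  then show False
    using sum.remove[OF assms(1,4), of x] assms(3,5) by simp
qed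

text \<open>A greedy sweep through \<open>B\<close> from left to right. If the selection so far
  misses the new point, equality of the weight totals forces some interval at that point to start no
  earlier than every previous point, so adding it covers nothing twice. The clause that selected
  intervals start before a point of \<open>B\<close> carries the induction: it yields uniqueness at
  the new point.\<close>

lemma exact_interval_cover:
  fixes s e x :: "'a \<Rightarrow> real"
  assumes "finite B" "finite J" "\<And>i. i \<in> J \<Longrightarrow> x i > 0"
    and "\<And>v. v \<in> B \<Longrightarrow> (\<Sum>i | i \<in> J \<and> s i < v \<and> v \<le> e i. x i) = 1"
  shows "\<exists>C \<subseteq> J. (\<forall>v \<in> B. \<exists>!i. i \<in> C \<and> s i < v \<and> v \<le> e i)
            \<and> (\<forall>i \<in> C. \<exists>v \<in> B. s i < v)"
  using assms(1,4)
proof (induction B rule: finite_linorder_max_induct)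
  case empty
  show ?case by (intro exI[of _ "{}"]) auto
next
  case (insert b A)
  define K where "K v = {i \<in> J. s i < v \<and> v \<le> e i}" for v
  have finK: "finite (K v)" for v
    using assms(2) by (auto simp: K_def)
  have posK: "x i > 0" if "i \<in> K v" for i v
    using that assms(3) by (auto simp: K_def)
  have sumK: "sum x (K v) = 1" if "v \<in> insert b A" for v
    using insert.prems[OF that] by (simp add: K_def)
  have "\<exists>C \<subseteq> J. (\<forall>v \<in> A. \<exists>!i. i \<in> C \<and> s i < v \<and> v \<le> e i)
      \<and> (\<forall>i \<in> C. \<exists>v \<in> A. s i < v)"
    using insert.prems by (intro insert.IH) auto
  then obtain C where CJ: "C \<subseteq> J"
    and C1: "\<And>v. v \<in> A \<Longrightarrow> \<exists>!i. i \<in> C \<and> s i < v \<and> v \<le> e i"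
    and C2: "\<And>i. i \<in> C \<Longrightarrow> \<exists>v \<in> A. s i < v"
    by (elim exE conjE) simp
  show ?case
  proof (cases "\<exists>i \<in> C. s i < b \<and> b \<le> e i")
    case True
    then obtain i where i: "i \<in> C" "s i < b" "b \<le> e i" by blast
    \<comment> \<open>Both intervals start before a point of \<open>A\<close> and reach
      \<open>b\<close>, so both contain the larger of these two points, which \<open>C\<close>
      covers only once.\<close>
    have uniq: "k = i" if k: "k \<in> C" "s k < b" "b \<le> e k" for k
    proof -
      obtain v where v: "v \<in> A" "s i < v"
        using C2 i by blast
      obtain w where w: "w \<in> A" "s k < w"
        using C2 k by blast
      have "max v w \<in> A"
        using v w by (simp add: max_def)
      moreover from this have "max v w < b"
        using insert.hyps by blast
      ultimately show "k = i"
        using C1[of "max v w"] i k v w by (metis less_max_iff_disj order.trans less_imp_le)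
    qed
    show ?thesis
    proof (intro exI[of _ C] conjI ballI)
      fix v assume "v \<in> insert b A"
      then show "\<exists>!i. i \<in> C \<and> s i < v \<and> v \<le> e i"
        using C1 i uniq by blast
    next
      fix i assume "i \<in> C"
      then show "\<exists>v \<in> insert b A. s i < v" using C2 by blast
    qed (use CJ in auto)
  next
    case False
    have "\<exists>j \<in> K b. \<forall>w \<in> A. w \<le> s j"
    proof (cases "A = {}")
      case True
      have "K b \<noteq> {}" using sumK[of b] by auto
      then show ?thesis using True by auto
    next
      case False': False
      define w where "w = Max A"
      have w: "w \<in> A" "\<And>v. v \<in> A \<Longrightarrow> v \<le> w"
        using False' insert.hyps(1) by (auto simp: w_def)
      obtain i where i: "i \<in> C" "s i < w" "w \<le> e i" using C1[OF w(1)] by blast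
      have "w < b" using insert.hyps w by blast
      have "i \<in> K w" using i CJ by (auto simp: K_def)
      have "i \<notin> K b" using False i by (auto simp: K_def)
      \<comment> \<open>Otherwise every interval at \<open>b\<close> also covers \<open>w\<close>;
        as \<open>i\<close> covers \<open>w\<close> but not \<open>b\<close>, the weight at
        \<open>b\<close> would fall below the weight at \<open>w\<close>, while both are 1.\<close>
      have "\<exists>j \<in> K b. w \<le> s j"
      proof (rule ccontr)
        assume "\<not> ?thesis"
        then have "K b \<subseteq> K w - {i}"
          using \<open>w < b\<close> \<open>i \<notin> K b\<close> by (fastforce simp: K_def)
        then have "sum x (K b) \<le> sum x (K w - {i})"
          using finK posK by (intro sum_mono2) (auto intro: less_imp_le)
        also have "\<dots> < sum x (K w)"
          using finK posK \<open>i \<in> K w\<close> by (simp add: sum_diff1)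
        finally show False using sumK w by simp
      qed
      then show ?thesis using w by (meson order.trans)
    qed
    then obtain j where j: "j \<in> K b" and jA: "\<And>w. w \<in> A \<Longrightarrow> w \<le> s j" by blast
    show ?thesis
    proof (intro exI[of _ "insert j C"] conjI ballI)
      show "insert j C \<subseteq> J" using CJ j by (auto simp: K_def)
      fix v assume "v \<in> insert b A"
      then show "\<exists>!i. i \<in> insert j C \<and> s i < v \<and> v \<le> e i"
      proof
        assume "v = b"
        then show ?thesis using j False by (auto simp: K_def)
      next
        assume "v \<in> A"
        then show ?thesis using C1[of v] jA[of v] by (metis insert_iff not_le)
      qed
    next
      fix i assume "i \<in> insert j C"
      then show "\<exists>v \<in> insert b A. s i < v"
        using C2 j by (auto simp: K_def)
    qed
  qed
qed

text \<open>The values \<open>r\<close> correct \<open>G\<close> to zero on \<open>V\<close>, jumping only at points \<open>e i\<close> strictly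
  between two neighbours of \<open>V\<close>.\<close>

lemma jump_correction:
  fixes G :: "real \<Rightarrow> real" and e :: "'a \<Rightarrow> real"
  assumes "finite V" "finite J" "\<And>v. v \<in> V \<Longrightarrow> (\<forall>w \<in> V. v \<le> w) \<Longrightarrow> G v = 0"
    and "\<And>v w. v \<in> V \<Longrightarrow> w \<in> V \<Longrightarrow> v < w \<Longrightarrow> (\<And>u. u \<in> V \<Longrightarrow> \<not> (v < u \<and> u < w)) \<Longrightarrow>
           (\<And>i. i \<in> J \<Longrightarrow> \<not> (v < e i \<and> e i < w)) \<Longrightarrow> G v = G w"
  shows "\<exists>r. (\<forall>i. r i \<noteq> 0 \<longrightarrow> i \<in> J \<and> e i \<notin> V \<and> (\<exists>v \<in> V. e i < v)) \<and>
             (\<forall>v \<in> V. G v + (\<Sum>i \<in> J. if e i \<le> v then r i else 0) = 0)"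
  using assms(1,3,4)
proof (induction V rule: finite_linorder_max_induct)
  case empty
  show ?case by (intro exI[of _ "\<lambda>_. 0"]) auto
next
  case (insert b A)
  show ?case
  proof (cases "A = {}")
    case True
    then have "G b = 0" using insert.prems(1)[of b] by auto
    then show ?thesis using True by (intro exI[of _ "\<lambda>_. 0"]) auto
  next
    case False
    define w where "w = Max A"
    have w: "w \<in> A" "\<And>v. v \<in> A \<Longrightarrow> v \<le> w" "w < b"
      using False insert.hyps by (auto simp: w_def)
    have prem1: "G v = 0" if "v \<in> A" "\<forall>w \<in> A. v \<le> w" for v
      using that insert.hyps(2) by (intro insert.prems(1)) (auto intro: less_imp_le)
    have prem2: "G v = G u" if "v \<in> A" "u \<in> A" "v < u" "\<And>t. t \<in> A \<Longrightarrow> \<not> (v < t \<and> t < u)"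
        "\<And>i. i \<in> J \<Longrightarrow> \<not> (v < e i \<and> e i < u)" for v u
    proof (rule insert.prems(2))
      fix t assume "t \<in> insert b A"
      then show "\<not> (v < t \<and> t < u)"
        using that(2,4) insert.hyps(2) by (metis insert_iff order.asym)
    qed (use that in auto)
    obtain r where r1: "\<And>i. r i \<noteq> 0 \<Longrightarrow> i \<in> J \<and> e i \<notin> A \<and> (\<exists>v \<in> A. e i < v)"
      and r2: "\<And>v. v \<in> A \<Longrightarrow> G v + (\<Sum>i \<in> J. if e i \<le> v then r i else 0) = 0"
      using insert.IH[OF prem1 prem2] by blast
    \<comment> \<open>A nonzero correction lies below some point of \<open>A\<close>, hence below
      \<open>w\<close>; so the old corrections have the same total at \<open>b\<close> as at
      \<open>w\<close>.\<close>
    have rw: "r i = 0" if "w \<le> e i" for i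
      using r1[of i] w(2) that by force
    have r1b: "r i \<noteq> 0 \<Longrightarrow> e i < b" for i
      using rw[of i] w(3) by force
    have eq: "(\<Sum>i \<in> J. if e i \<le> b then r i else 0) = (\<Sum>i \<in> J. if e i \<le> w then r i else 0)"
      using rw w(3) by (intro sum.cong) auto
    show ?thesis
    proof (cases "\<exists>j \<in> J. w < e j \<and> e j < b")
      case True
      then obtain j where j: "j \<in> J" "w < e j" "e j < b" by blast
      \<comment> \<open>The old corrections total \<open>- G w\<close> at \<open>b\<close>; this
        jump turns that into \<open>- G b\<close>. It overwrites a zero, by \<open>rw\<close>, and
        no point of \<open>A\<close> sees it because \<open>w < e j\<close>.\<close>
      define r' where "r' = r(j := G w - G b)"
      have r'A: "(\<Sum>i \<in> J. if e i \<le> v then r' i else 0) = (\<Sum>i \<in> J. if e i \<le> v then r i else 0)"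
        if "v \<in> A" for v
        using w(2)[OF that] j by (intro sum.cong) (auto simp: r'_def)
      have "(\<Sum>i \<in> J. if e i \<le> b then r' i else 0)
          = (\<Sum>i \<in> J. (if e i \<le> b then r i else 0) + (if i = j then G w - G b else 0))"
        using j rw[of j] by (intro sum.cong) (auto simp: r'_def)
      also have "\<dots> = (\<Sum>i \<in> J. if e i \<le> w then r i else 0) + (G w - G b)"
        using j assms(2) by (simp add: sum.distrib eq)
      finally have "G b + (\<Sum>i \<in> J. if e i \<le> b then r' i else 0) = 0"
        using r2[OF w(1)] by simp
      moreover have "i \<in> J \<and> e i \<notin> insert b A \<and> (\<exists>v \<in> insert b A. e i < v)"
        if "r' i \<noteq> 0" for i
      proof (cases "i = j")
        case True
        then show ?thesis using j w(2) by force
      next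
        case False
        then show ?thesis using that r1[of i] r1b[of i] by (auto simp: r'_def)
      qed
      ultimately show ?thesis
        using r'A r2 by (intro exI[of _ r']) auto
    next
      case False
      have "G w = G b"
      proof (rule insert.prems(2))
        fix u assume "u \<in> insert b A"
        then show "\<not> (w < u \<and> u < b)" using w(2) by force
      qed (use False w in auto)
      then have "G b + (\<Sum>i \<in> J. if e i \<le> b then r i else 0) = 0"
        using eq r2[OF w(1)] by simp
      then have "\<forall>v \<in> insert b A. G v + (\<Sum>i \<in> J. if e i \<le> v then r i else 0) = 0"
        using r2 by simp
      moreover have "\<forall>i. r i \<noteq> 0 \<longrightarrow> i \<in> J \<and> e i \<notin> insert b A \<and> (\<exists>v \<in> insert b A. e i < v)"
        using r1 r1b by force
      ultimately show ?thesis by blast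
    qed
  qed
qed

text \<open>The test applied to each linear constraint along a line: slack absorbs small moves, a
  tight constraint needs zero slope. The filter \<open>nhds 0\<close> covers both signs of
  \<open>t\<close>, as the extreme point argument requires.\<close>

lemma eventually_nonneg_perturbation:
  fixes f g :: real
  assumes "f \<ge> 0" "f = 0 \<Longrightarrow> g = 0"
  shows "\<forall>\<^sub>F t in nhds 0. f + t * g \<ge> 0"
proof (cases "f = 0")
  case False
  have "((\<lambda>t. f + t * g) \<longlongrightarrow> f + 0 * g) (nhds 0)"
    by (intro tendsto_intros filterlim_ident)
  then have "\<forall>\<^sub>F t in nhds 0. f + t * g > 0"
    using assms False by (intro order_tendstoD) auto
  then show ?thesis
    by eventually_elim simp
qed (use assms in simp)


text \<open>Between \<open>v\<close> and \<open>w\<close> only intervals in \<open>C\<close>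
  contribute to the growth of \<open>F\<close>. After their last start the slope is
  \<open>sum x C\<close>, at most 1 because \<open>F\<close> is on or above the diagonal there and
  on it at \<open>w\<close>. Over the whole block \<open>F\<close> gains \<open>w - v\<close>, so
  the sum is also at least 1, and a start after \<open>v\<close> would make the gain too
  small.\<close>

lemma tight_block:
  fixes x a s :: "'a \<Rightarrow> real"
  assumes "finite N" and x: "\<And>i. i \<in> N \<Longrightarrow> x i \<ge> 0"
    and ax: "\<And>i. i \<in> N \<Longrightarrow> a i \<ge> 0" "\<And>i. i \<in> N \<Longrightarrow> a i > 0 \<Longrightarrow> x i > 0"
    and F: "\<And>u. F u = (\<Sum>i \<in> N. x i * min (a i) (max 0 (u - s i)))"
    and Fs: "\<And>i. i \<in> N \<Longrightarrow> F (s i) \<ge> s i"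
    and vw: "F v = v" "F w = w" "v < w"
    and no_end: "\<And>i. i \<in> N \<Longrightarrow> a i > 0 \<Longrightarrow> \<not> (v < s i + a i \<and> s i + a i < w)"
  defines "C \<equiv> {i \<in> N. s i < w \<and> w \<le> s i + a i}"
  shows "sum x C = 1" and "\<And>i. i \<in> C \<Longrightarrow> s i \<le> v"
proof -
  have finC: "finite C" and CN: "C \<subseteq> N"
    using assms(1) by (auto simp: C_def)
  have xC: "x i > 0" if "i \<in> C" for i
    using that ax(2)[of i] by (auto simp: C_def)
  \<comment> \<open>An interval outside \<open>C\<close> is empty, starts at \<open>w\<close> or
    later, or ends by \<open>v\<close>, since none ends strictly between; its share of
    \<open>F\<close> is constant here.\<close>
  have diff: "F w - F u = (\<Sum>i \<in> C. x i * (w - max u (s i)))" if u: "v \<le> u" "u < w" for u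
  proof -
    have "x i * min (a i) (max 0 (w - s i)) - x i * min (a i) (max 0 (u - s i))
        = (if i \<in> C then x i * (w - max u (s i)) else 0)" if i: "i \<in> N" for i
    proof -
      have "min (a i) (max 0 (w - s i)) - min (a i) (max 0 (u - s i))
          = (if i \<in> C then w - max u (s i) else 0)"
        using u i no_end[OF i] ax(1)[OF i] by (auto simp: C_def min_def max_def split: if_splits)
      then show ?thesis
        by (metis mult_zero_right right_diff_distrib)
    qed
    then have "F w - F u = (\<Sum>i \<in> N. if i \<in> C then x i * (w - max u (s i)) else 0)"
      unfolding F sum_subtractf[symmetric] by (intro sum.cong) auto
    also have "\<dots> = (\<Sum>i \<in> C. x i * (w - max u (s i)))"
      using CN assms(1) by (simp add: sum.inter_restrict[symmetric] Int_absorb1)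
    finally show ?thesis .
  qed
  \<comment> \<open>The last start in \<open>C\<close>, or \<open>v\<close> if none is later: beyond
    it all of \<open>C\<close> is active, and \<open>F u \<ge> u\<close> holds in either
    case.\<close>
  define u where "u = Max (insert v (s ` C))"
  have uv: "v \<le> u" and us: "\<And>i. i \<in> C \<Longrightarrow> s i \<le> u"
    using finC by (auto simp: u_def)
  have umem: "u \<in> insert v (s ` C)"
    unfolding u_def using finC by (intro Max_in) auto
  then have "u < w" and "F u \<ge> u"
    using vw Fs CN by (auto simp: C_def)
  have "(w - u) * sum x C = (\<Sum>i \<in> C. x i * (w - max u (s i)))"
    unfolding sum_distrib_left using us by (intro sum.cong) (simp_all add: max_absorb1 mult.commute)
  also have "\<dots> \<le> w - u"
    using diff[OF uv \<open>u < w\<close>] vw \<open>F u \<ge> u\<close> by simp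
  finally have le1: "sum x C \<le> 1"
    using \<open>u < w\<close> by (simp add: mult_le_cancel_left1)
  have eq: "(\<Sum>i \<in> C. x i * (w - max v (s i))) = w - v"
    using diff[of v] vw by simp
  have le: "x i * (w - max v (s i)) \<le> (w - v) * x i" if "i \<in> C" for i
    using xC[OF that] by (simp add: mult.commute)
  have "(\<Sum>i \<in> C. x i * (w - max v (s i))) \<le> (\<Sum>i \<in> C. (w - v) * x i)"
    using le by (rule sum_mono)
  then have "w - v \<le> (w - v) * sum x C"
    using eq by (simp add: sum_distrib_left)
  then have "1 \<le> sum x C"
    using vw by (simp add: mult_le_cancel_left1)
  with le1 show sum1: "sum x C = 1" by simp
  show "s i \<le> v" if i: "i \<in> C" for i
  proof (rule ccontr)
    assume "\<not> s i \<le> v"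
    then have "x i * (w - max v (s i)) < (w - v) * x i"
      using xC[OF i] by (simp add: mult.commute)
    then have "(\<Sum>i \<in> C. x i * (w - max v (s i))) < (\<Sum>i \<in> C. (w - v) * x i)"
      using finC i le by (intro sum_strict_mono_ex1) auto
    also have "\<dots> = w - v"
      using sum1 by (simp add: sum_distrib_left[symmetric])
    finally show False using eq by simp
  qed
qed

section \<open>The (l, S) polytope and its fractional points\<close>

text \<open>Deterministic lot-sizing with cumulative demands \<open>D\<close> and capacities
  \<open>M\<close>. The demand constraints are included as the case
  \<open>S = {1..l}\<close>.\<close>

definition lot_sizing_polytope ::
  "nat \<Rightarrow> (nat \<Rightarrow> real) \<Rightarrow> (nat \<Rightarrow> real) \<Rightarrow> (nat \<Rightarrow> real) \<Rightarrow> (nat \<Rightarrow> real) \<Rightarrow> bool" where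
  "lot_sizing_polytope n D M x y \<longleftrightarrow>
     (\<forall>i \<in> {1..n}. 0 \<le> x i \<and> x i \<le> 1 \<and> 0 \<le> y i \<and> y i \<le> M i * x i) \<and>
     (\<forall>l \<in> {1..n}. \<forall>S \<subseteq> {1..l}.
        D l \<le> (\<Sum>i \<in> S. y i) + (\<Sum>i \<in> {1..l} - S. (D l - D (i - 1)) * x i))"

lemma lot_sizing_polytope_cong:
  assumes "\<And>i. i \<in> {1..n} \<Longrightarrow> x i = x' i" "\<And>i. i \<in> {1..n} \<Longrightarrow> y i = y' i"
  shows "lot_sizing_polytope n D M x y \<longleftrightarrow> lot_sizing_polytope n D M x' y'"
proof -
  have "sum y S = sum y' S" "(\<Sum>i \<in> {1..l} - S. (D l - D (i - 1)) * x i)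
      = (\<Sum>i \<in> {1..l} - S. (D l - D (i - 1)) * x' i)"
    if "l \<in> {1..n}" "S \<subseteq> {1..l}" for l S
    using that assms by (auto intro!: sum.cong)
  then show ?thesis
    using assms by (simp add: lot_sizing_polytope_def)
qed

text \<open>\<open>x\<close> moves towards an exact cover, and \<open>y\<close> follows in
  proportion, with corrections at interval ends that are not tight values. The bound on
  \<open>M\<close> makes an interval at full capacity reach \<open>D n\<close>, so that it is never
  corrected.\<close>

lemma fractional_perturbation:
  assumes P: "lot_sizing_polytope n D M x y"
    and D0: "D 0 = 0" and mono: "\<And>i j. i \<le> j \<Longrightarrow> j \<le> n \<Longrightarrow> D i \<le> D j"
    and M: "\<And>i. i \<in> {1..n} \<Longrightarrow> D n - D (i - 1) \<le> M i"
    and frac: "k \<in> {1..n}" "0 < x k" "x k < 1"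
  shows "\<exists>dx dy. dx k \<noteq> 0 \<and>
    (\<forall>\<^sub>F t in nhds 0. lot_sizing_polytope n D M (\<lambda>i. x i + t * dx i) (\<lambda>i. y i + t * dy i))"
proof -
  define N where "N = {1..n}"
  define s where "s i = D (i - 1)" for i
  \<comment> \<open>Division by zero gives length 0 when \<open>x i = 0\<close>, which fits:
    \<open>y i \<le> M i * x i\<close> then forces \<open>y i = 0\<close>.\<close>
  define a where "a i = y i / x i" for i
  define e where "e i = s i + a i" for i
  define c where "c i v = min (a i) (max 0 (v - s i))" for i v
  define F where "F v = (\<Sum>i \<in> N. x i * c i v)" for v
  have finN: "finite N" by (simp add: N_def)
  have x0: "x i \<ge> 0" and x1: "x i \<le> 1" and y0: "y i \<ge> 0" and yM: "y i \<le> M i * x i"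
    if "i \<in> N" for i
    using P that by (auto simp: lot_sizing_polytope_def N_def)
  have yx: "y i = a i * x i" if "i \<in> N" for i
    using yM[OF that] y0[OF that] by (cases "x i = 0") (auto simp: a_def)
  have a0: "a i \<ge> 0" if "i \<in> N" for i
    using x0[OF that] y0[OF that] by (simp add: a_def)
  have ax: "x i > 0" if "i \<in> N" "a i > 0" for i
    using x0[OF that(1)] that(2) by (cases "x i = 0") (auto simp: a_def)
  have s0: "s i \<ge> 0" if "i \<in> N" for i
    using mono[of 0 "i - 1"] D0 that by (auto simp: s_def N_def)
  \<comment> \<open>\<open>x i * c i v\<close> is below both terms that an (l, S) inequality can use
    for period \<open>i\<close>, so \<open>F (D l)\<close> bounds all these sums from below.\<close>
  have c_le: "x i * c i v \<le> y i" "v \<ge> s i \<Longrightarrow> x i * c i v \<le> (v - s i) * x i" if "i \<in> N" for i v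
    unfolding yx[OF that] mult.commute[of "x i"]
    by (auto simp: c_def intro!: mult_right_mono x0[OF that])
  have s_le: "s i \<le> D l" if "i \<in> {1..l}" "l \<in> {1..n}" for i l
    using mono[of "i - 1" l] that by (auto simp: s_def)
  have c_late: "c i (D l) = 0" if "i \<in> N - {1..l}" "l \<in> {0..n}" for i l
  proof -
    have "D l \<le> s i" using mono[of l "i - 1"] that by (auto simp: s_def N_def)
    then show ?thesis using a0[of i] that by (simp add: c_def)
  qed
  have F_split: "F (D l) = (\<Sum>i \<in> {1..l}. x i * c i (D l))" if "l \<in> {1..n}" for l
    unfolding F_def using that c_late[of _ l]
    by (intro sum.mono_neutral_right) (auto simp: N_def)
  have F0: "F 0 = 0"
    unfolding F_def using s0 a0 by (intro sum.neutral) (auto simp: c_def)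
  have FD: "F (D l) \<ge> D l" if l: "l \<in> {0..n}" for l
  proof (cases "l = 0")
    case False
    then have l': "l \<in> {1..n}" using l by auto
    \<comment> \<open>Taking the smaller term for every period makes the (l, S) sum equal to
      \<open>F (D l)\<close>.\<close>
    define S where "S = {i \<in> {1..l}. a i \<le> D l - s i}"
    have S: "S \<subseteq> {1..l}" by (auto simp: S_def)
    have iN: "i \<in> N" if "i \<in> {1..l}" for i using that l' by (auto simp: N_def)
    have "D l \<le> (\<Sum>i \<in> S. y i) + (\<Sum>i \<in> {1..l} - S. (D l - s i) * x i)"
      using P l' S by (auto simp: lot_sizing_polytope_def s_def)
    also have "(\<Sum>i \<in> S. y i) = (\<Sum>i \<in> S. x i * c i (D l))"
      using yx[OF iN] a0[OF iN] s_le[OF _ l']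
      by (intro sum.cong) (auto simp: S_def c_def min_def max_def)
    also have "(\<Sum>i \<in> {1..l} - S. (D l - s i) * x i) = (\<Sum>i \<in> {1..l} - S. x i * c i (D l))"
      using s_le[OF _ l'] by (intro sum.cong) (auto simp: S_def c_def min_def max_def)
    also have "(\<Sum>i \<in> S. x i * c i (D l)) + (\<Sum>i \<in> {1..l} - S. x i * c i (D l)) = F (D l)"
      unfolding F_split[OF l'] using sum.subset_diff[OF S, of "\<lambda>i. x i * c i (D l)"] by simp
    finally show ?thesis .
  qed (use F0 D0 in simp)
  have Fs: "F (s i) \<ge> s i" if "i \<in> N" for i
    using FD[of "i - 1"] that by (auto simp: s_def N_def)
  \<comment> \<open>The tight values; consecutive members bound the blocks, the first of which
    starts at 0.\<close>
  define V where "V = {v \<in> D ` {0..n}. F v = v}"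
  have finV: "finite V" by (simp add: V_def)
  have V0: "0 \<in> V" using D0 F0 by (force simp: V_def)
  have Vn: "0 \<le> v" "v \<le> D n" "F v = v" if "v \<in> V" for v
    using that mono[of 0] mono[of _ n] D0 by (auto simp: V_def)
  define J where "J = {i \<in> N. a i > 0}"
  have finJ: "finite J" and JN: "J \<subseteq> N" using finN by (auto simp: J_def)
  define cov where "cov v = {i \<in> J. s i < v \<and> v \<le> e i}" for v
  \<comment> \<open>Right ends of the blocks with no interval end inside. No correction of
    \<open>y\<close> is possible there, so the covering weights must keep their sum.\<close>
  define B where "B = {w \<in> V. \<exists>v \<in> V. v < w \<and> (\<forall>i \<in> J. \<not> (v < e i \<and> e i < w))
      \<and> (\<forall>u \<in> V. \<not> (v < u \<and> u < w))}"
  have cov_eq: "cov v = {i \<in> N. s i < v \<and> v \<le> s i + a i}" for v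
    by (auto simp: cov_def J_def e_def)
  have block: "sum x (cov w) = 1" "\<And>i. i \<in> cov w \<Longrightarrow> s i \<le> v"
    if "v \<in> V" "w \<in> V" "v < w" "\<And>i. i \<in> J \<Longrightarrow> \<not> (v < e i \<and> e i < w)" for v w
  proof -
    have Feq: "F u = (\<Sum>i \<in> N. x i * min (a i) (max 0 (u - s i)))" for u
      by (simp add: F_def c_def)
    have no_end: "\<And>i. i \<in> N \<Longrightarrow> a i > 0 \<Longrightarrow> \<not> (v < s i + a i \<and> s i + a i < w)"
      using that(4) by (auto simp: J_def e_def)
    note tb = tight_block[of N x a F s v w, OF finN x0 a0 ax Feq Fs Vn(3)[OF that(1)] Vn(3)[OF that(2)] that(3) no_end]
    show "sum x (cov w) = 1" unfolding cov_eq by (rule tb(1)) auto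
    show "\<And>i. i \<in> cov w \<Longrightarrow> s i \<le> v" unfolding cov_eq by (rule tb(2)) auto
  qed
  have xJ: "x i > 0" if "i \<in> J" for i using ax that by (auto simp: J_def)

  \<comment> \<open>Direction of the move\<close>
  obtain C where C: "C \<subseteq> J" "\<And>v. v \<in> B \<Longrightarrow> \<exists>!i. i \<in> C \<and> s i < v \<and> v \<le> e i"
  proof -
    have "(\<Sum>i | i \<in> J \<and> s i < w \<and> w \<le> e i. x i) = 1" if "w \<in> B" for w
      using that block(1) unfolding B_def cov_def by blast
    then have "\<exists>C \<subseteq> J. (\<forall>v \<in> B. \<exists>!i. i \<in> C \<and> s i < v \<and> v \<le> e i) \<and> (\<forall>i \<in> C. \<exists>v \<in> B. s i < v)"
      using finV finJ xJ by (intro exact_interval_cover[where x = x]) (simp_all add: B_def)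
    then show ?thesis using that by (elim exE conjE) simp
  qed
  \<comment> \<open>Points from \<open>x\<close> to the indicator of the selection \<open>C\<close>,
    leaving integral coordinates fixed.\<close>
  define dx where "dx i = (if 0 < x i \<and> x i < 1 then of_bool (i \<in> C) - x i else 0)" for i
  \<comment> \<open>A weight 1 leaves no room for a second interval, and it does not move. Otherwise
    all weights are fractional with sum 1 and exactly one of the intervals is selected, giving 1 -
    1.\<close>
  have dx_cov: "sum dx (cov w) = 0" if w: "w \<in> B" for w
  proof -
    have sum1: "sum x (cov w) = 1" using w block(1) unfolding B_def by blast
    have fin: "finite (cov w)" using finJ by (simp add: cov_def)
    show ?thesis
    proof (cases "\<exists>i \<in> cov w. x i = 1")
      case True
      then obtain i where i: "i \<in> cov w" "x i = 1" by blast
      have "cov w = {i}"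
        using fin _ sum1 i by (rule sum_pos_eq_1_imp_singleton) (use xJ in \<open>auto simp: cov_def\<close>)
      then show ?thesis using i by (simp add: dx_def)
    next
      case False
      obtain j where j: "j \<in> C" "s j < w" "w \<le> e j"
        and uniq: "\<And>i. i \<in> C \<Longrightarrow> s i < w \<Longrightarrow> w \<le> e i \<Longrightarrow> i = j"
        using C(2)[OF w] by blast
      have jc: "j \<in> cov w" using j C(1) by (auto simp: cov_def)
      have "dx i = of_bool (i = j) - x i" if i: "i \<in> cov w" for i
      proof -
        have "i \<in> J" "s i < w" "w \<le> e i" using i by (auto simp: cov_def)
        moreover from this have "0 < x i" "x i < 1"
          using xJ x1[of i] False i JN by force+
        moreover have "i \<in> C \<longleftrightarrow> i = j"
          using uniq j(1) calculation by blast
        ultimately show ?thesis by (simp add: dx_def)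
      qed
      then have "sum dx (cov w) = (\<Sum>i \<in> cov w. of_bool (i = j) - x i)"
        by (intro sum.cong) auto
      also have "\<dots> = (\<Sum>i \<in> cov w. if i = j then 1 else 0) - sum x (cov w)"
        unfolding sum_subtractf of_bool_def ..
      also have "\<dots> = 0" using fin jc sum1 by simp
      finally show ?thesis .
    qed
  qed
  \<comment> \<open>Rate of change of \<open>F v\<close> when \<open>x\<close> moves along
    \<open>dx\<close> with the lengths \<open>a i\<close> fixed.\<close>
  define G where "G v = (\<Sum>i \<in> N. dx i * c i v)" for v
  \<comment> \<open>By \<open>block\<close>, the intervals in \<open>cov w\<close> span the whole
    block and each gains length \<open>w - v\<close>; the others gain nothing. The difference is
    \<open>w - v\<close> times the sum that vanishes by \<open>dx_cov\<close>.\<close>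
  have G_const: "G v = G w"
    if "v \<in> V" "w \<in> V" "v < w" "\<And>u. u \<in> V \<Longrightarrow> \<not> (v < u \<and> u < w)"
      and no_end: "\<And>i. i \<in> J \<Longrightarrow> \<not> (v < e i \<and> e i < w)" for v w
  proof -
    have "w \<in> B" using that by (auto simp: B_def)
    have "dx i * c i w - dx i * c i v = (if i \<in> cov w then (w - v) * dx i else 0)" if i: "i \<in> N" for i
    proof -
      have "c i w - c i v = (if i \<in> cov w then w - v else 0)"
      proof (cases "i \<in> cov w")
        case True
        then have "s i \<le> v" by (rule block(2)[OF \<open>v \<in> V\<close> \<open>w \<in> V\<close> \<open>v < w\<close> no_end, rotated])
        then show ?thesis
          using True \<open>v < w\<close> by (auto simp: cov_def c_def e_def)
      next
        case False
        consider "a i = 0" | "w \<le> s i" | "0 < a i" "s i + a i \<le> v"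
          using False i no_end[of i] a0[OF i] by (force simp: cov_eq J_def e_def)
        then show ?thesis
          using False a0[OF i] \<open>v < w\<close> by cases (auto simp: c_def)
      qed
      then show ?thesis
        by (metis mult.commute mult_zero_right right_diff_distrib)
    qed
    then have "G w - G v = (\<Sum>i \<in> N. if i \<in> cov w then (w - v) * dx i else 0)"
      unfolding G_def sum_subtractf[symmetric] by (intro sum.cong) auto
    also have "\<dots> = (w - v) * sum dx (cov w)"
    proof -
      have "cov w \<subseteq> N" by (auto simp: cov_eq)
      then show ?thesis
        using finN by (simp add: sum.inter_restrict[symmetric] sum_distrib_left Int_absorb1)
    qed
    also have "\<dots> = 0" using dx_cov[OF \<open>w \<in> B\<close>] by simp
    finally show ?thesis by simp
  qed
  have "G v = 0" if "v \<in> V" "\<forall>w \<in> V. v \<le> w" for v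
  proof -
    have "v = 0" using that V0 Vn(1) by force
    then show ?thesis unfolding G_def using s0 a0 by (intro sum.neutral) (auto simp: c_def)
  qed
  then obtain r where r: "\<And>i. r i \<noteq> 0 \<Longrightarrow> i \<in> J \<and> e i \<notin> V \<and> (\<exists>v \<in> V. e i < v)"
    and Gr: "\<And>v. v \<in> V \<Longrightarrow> G v + (\<Sum>i \<in> J. if e i \<le> v then r i else 0) = 0"
    using jump_correction[OF finV finJ, of G e] G_const by blast
  \<comment> \<open>The first summand preserves the ratio of \<open>y i\<close> to
    \<open>x i\<close>; \<open>r i\<close> alters the length.\<close>
  define dy where "dy i = a i * dx i + r i" for i
  \<comment> \<open>Rate of change of the share of interval \<open>i\<close> in \<open>F v\<close>:
    a correction at the end \<open>e i\<close> counts only if that end is not beyond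
    \<open>v\<close>.\<close>
  define h where "h i v = dx i * c i v + (if e i \<le> v then r i else 0)" for i v
  have rJ: "r i = 0" if "i \<notin> J" for i using r that by blast
  have H: "(\<Sum>i \<in> N. h i v) = 0" if "v \<in> V" for v
  proof -
    have "(\<Sum>i \<in> N. if e i \<le> v then r i else 0) = (\<Sum>i \<in> J. if e i \<le> v then r i else 0)"
      using finN JN rJ by (intro sum.mono_neutral_right) auto
    then show ?thesis using Gr[OF that] by (simp add: h_def sum.distrib G_def)
  qed
  have dx0: "dx i = 0" if "x i = 0" for i using that by (simp add: dx_def)
  have r0: "r i = 0" if "x i = 0" for i using that xJ rJ by force

  \<comment> \<open>Feasibility of the move\<close>
  have bounds: "\<forall>\<^sub>F t in nhds 0. 0 \<le> x i + t * dx i \<and> x i + t * dx i \<le> 1 \<and>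
      0 \<le> y i + t * dy i \<and> y i + t * dy i \<le> M i * (x i + t * dx i)" if i: "i \<in> N" for i
  proof -
    have 1: "\<forall>\<^sub>F t in nhds 0. 0 \<le> x i + t * dx i"
      using x0[OF i] by (intro eventually_nonneg_perturbation) (auto simp: dx_def)
    have 2: "\<forall>\<^sub>F t in nhds 0. 0 \<le> (1 - x i) + t * (- dx i)"
      using x1[OF i] by (intro eventually_nonneg_perturbation) (auto simp: dx_def)
    have 3: "\<forall>\<^sub>F t in nhds 0. 0 \<le> y i + t * dy i"
    proof (rule eventually_nonneg_perturbation[OF y0[OF i]])
      assume "y i = 0"
      then have "a i = 0" by (simp add: a_def)
      then show "dy i = 0" using rJ[of i] by (simp add: dy_def J_def)
    qed
    have 4: "\<forall>\<^sub>F t in nhds 0. 0 \<le> (M i * x i - y i) + t * (M i * dx i - dy i)"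
    proof (rule eventually_nonneg_perturbation)
      show "M i * x i - y i \<ge> 0" using yM[OF i] by simp
      assume eq: "M i * x i - y i = 0"
      show "M i * dx i - dy i = 0"
      proof (cases "x i = 0")
        case True
        then show ?thesis by (simp add: dy_def dx0 r0)
      next
        case False
        then have "a i = M i" using eq by (simp add: a_def field_simps)
        \<comment> \<open>A correction needs an end strictly below some tight value, hence below
          \<open>D n\<close>, but an interval at full capacity reaches \<open>D n\<close>.\<close>
        moreover have "r i = 0"
        proof (rule ccontr)
          assume "r i \<noteq> 0"
          then have "e i < D n" using r[of i] Vn(2) by force
          then show False
            using M[of i] i \<open>a i = M i\<close> by (simp add: e_def s_def N_def)
        qed
        ultimately show ?thesis by (simp add: dy_def)
      qed
    qed
    show ?thesis
      using 1 2 3 4 by eventually_elim (auto simp: algebra_simps)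
  qed
  have cuts: "\<forall>\<^sub>F t in nhds 0. D l \<le> (\<Sum>i \<in> S. y i + t * dy i)
      + (\<Sum>i \<in> {1..l} - S. (D l - D (i - 1)) * (x i + t * dx i))"
    if l: "l \<in> {1..n}" and S: "S \<subseteq> {1..l}" for l S
  proof -
    define f where "f = (\<Sum>i \<in> S. y i) + (\<Sum>i \<in> {1..l} - S. (D l - s i) * x i)"
    define g where "g = (\<Sum>i \<in> S. dy i) + (\<Sum>i \<in> {1..l} - S. (D l - s i) * dx i)"
    have iN: "i \<in> N" if "i \<in> {1..l}" for i using that l by (auto simp: N_def)
    define \<phi> where "\<phi> i = (if i \<in> S then y i else (D l - s i) * x i)" for i
    define \<psi> where "\<psi> i = (if i \<in> S then dy i else (D l - s i) * dx i)" for i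
    have split: "(\<Sum>i \<in> S. p i) + (\<Sum>i \<in> {1..l} - S. q i) = (\<Sum>i \<in> {1..l}. if i \<in> S then p i else q i)"
      for p q :: "nat \<Rightarrow> real"
      using sum.subset_diff[OF S, of "\<lambda>i. if i \<in> S then p i else q i"] S
      by (simp add: sum.If_cases Int_absorb1 Diff_eq)
    have f\<phi>: "f = sum \<phi> {1..l}" and g\<psi>: "g = sum \<psi> {1..l}"
      unfolding f_def g_def \<phi>_def \<psi>_def by (rule split)+
    have \<phi>_ge: "x i * c i (D l) \<le> \<phi> i" if "i \<in> {1..l}" for i
      using c_le[OF iN[OF that]] s_le[OF that l] by (simp add: \<phi>_def)
    have "\<forall>\<^sub>F t in nhds 0. 0 \<le> (f - D l) + t * g"
    proof (rule eventually_nonneg_perturbation)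
      show "f - D l \<ge> 0"
        using P l S by (auto simp: lot_sizing_polytope_def f_def s_def)
      assume "f - D l = 0"
      then have tight: "sum \<phi> {1..l} = D l" by (simp add: f\<phi>)
      \<comment> \<open>Tightness squeezes \<open>F (D l)\<close> to \<open>D l\<close>. Hence
        \<open>D l\<close> is in \<open>V\<close>, and the bound \<open>\<phi>_ge\<close> is an
        equality in every term.\<close>
      have "F (D l) \<le> sum \<phi> {1..l}"
        unfolding F_split[OF l] using \<phi>_ge by (rule sum_mono)
      then have FDl: "F (D l) = D l" using FD[of l] l tight by simp
      then have DV: "D l \<in> V" using l by (auto simp: V_def)
      have \<phi>_eq: "\<phi> i = x i * c i (D l)" if i: "i \<in> {1..l}" for i
      proof (rule ccontr)
        assume "\<phi> i \<noteq> x i * c i (D l)"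
        then have "(\<Sum>i \<in> {1..l}. x i * c i (D l)) < sum \<phi> {1..l}"
          using \<phi>_ge i by (intro sum_strict_mono_ex1 bexI[of _ i]) (auto simp: order.strict_iff_order)
        then show False using FDl F_split[OF l] tight by simp
      qed
      \<comment> \<open>For \<open>x i > 0\<close>, equality of the terms means that the interval
        ends by \<open>D l\<close> if \<open>i\<close> is in \<open>S\<close> and reaches
        \<open>D l\<close> otherwise. An end exactly at \<open>D l\<close> carries no correction,
        because \<open>D l\<close> is in \<open>V\<close>.\<close>
      have \<psi>_eq: "\<psi> i = h i (D l)" if i: "i \<in> {1..l}" for i
      proof (cases "x i = 0")
        case True
        then show ?thesis by (simp add: \<psi>_def h_def dy_def dx0 r0)
      next
        case False
        then have "x i > 0" using x0[OF iN[OF i]] by simp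
        show ?thesis
        proof (cases "i \<in> S")
          case True
          then have "a i = c i (D l)"
            using \<phi>_eq[OF i] yx[OF iN[OF i]] False by (simp add: \<phi>_def)
          moreover from this have "e i \<le> D l"
            using s_le[OF i l] by (auto simp: c_def e_def)
          ultimately show ?thesis using True by (simp add: \<psi>_def h_def dy_def)
        next
          case ninS: False
          then have "c i (D l) = D l - s i"
            using \<phi>_eq[OF i] False by (simp add: \<phi>_def)
          moreover from this have "e i \<ge> D l"
            by (simp add: c_def e_def)
          then have "e i \<le> D l \<Longrightarrow> r i = 0"
            using r[of i] DV by auto
          ultimately show ?thesis using ninS by (simp add: \<psi>_def h_def)
        qed
      qed
      \<comment> \<open>Later periods start at \<open>D l\<close> or beyond; an interval of theirs
        that ends by \<open>D l\<close> is empty and has no correction.\<close>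
      have "h i (D l) = 0" if i: "i \<in> N - {1..l}" for i
      proof -
        have "D l \<le> s i" using mono[of l "i - 1"] i by (auto simp: s_def N_def)
        then have "e i \<le> D l \<Longrightarrow> i \<notin> J"
          by (auto simp: e_def J_def)
        then show ?thesis using c_late[OF i] l rJ by (auto simp: h_def)
      qed
      then have "(\<Sum>i \<in> {1..l}. h i (D l)) = (\<Sum>i \<in> N. h i (D l))"
        using l by (intro sum.mono_neutral_left) (auto simp: N_def)
      then show "g = 0" using \<psi>_eq H[OF DV] by (simp add: g\<psi>)
    qed
    moreover have "(\<Sum>i \<in> S. y i + t * dy i) + (\<Sum>i \<in> {1..l} - S. (D l - D (i - 1)) * (x i + t * dx i))
        = f + t * g" for t
    proof -
      have "(D l - D (i - 1)) * (x i + t * dx i) = (D l - s i) * x i + t * ((D l - s i) * dx i)" for i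
        by (simp add: s_def algebra_simps)
      then show ?thesis
        by (simp add: f_def g_def sum.distrib sum_distrib_left[symmetric] distrib_left)
    qed
    ultimately show ?thesis by (simp add: algebra_simps)
  qed
  have "\<forall>\<^sub>F t in nhds 0. lot_sizing_polytope n D M (\<lambda>i. x i + t * dx i) (\<lambda>i. y i + t * dy i)"
    unfolding lot_sizing_polytope_def
  \<comment> \<open>Only finitely many constraints occur, so they hold jointly near 0;
    \<open>Pow {1..l}\<close> presents the range of \<open>S\<close> as a finite set.\<close>
  proof (intro eventually_conj)
    show "\<forall>\<^sub>F t in nhds 0. \<forall>i \<in> {1..n}. 0 \<le> x i + t * dx i \<and> x i + t * dx i \<le> 1 \<and>
        0 \<le> y i + t * dy i \<and> y i + t * dy i \<le> M i * (x i + t * dx i)"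
      using bounds by (intro eventually_ball_finite) (auto simp: N_def)
    have "\<forall>\<^sub>F t in nhds 0. \<forall>S \<in> Pow {1..l}. D l \<le> (\<Sum>i \<in> S. y i + t * dy i)
      + (\<Sum>i \<in> {1..l} - S. (D l - D (i - 1)) * (x i + t * dx i))" if "l \<in> {1..n}" for l
      using cuts[OF that] by (intro eventually_ball_finite) auto
    then have "\<forall>\<^sub>F t in nhds 0. \<forall>l \<in> {1..n}. \<forall>S \<in> Pow {1..l}. D l \<le> (\<Sum>i \<in> S. y i + t * dy i)
      + (\<Sum>i \<in> {1..l} - S. (D l - D (i - 1)) * (x i + t * dx i))"
      by (intro eventually_ball_finite) auto
    then show "\<forall>\<^sub>F t in nhds 0. \<forall>l \<in> {1..n}. \<forall>S \<subseteq> {1..l}. D l \<le> (\<Sum>i \<in> S. y i + t * dy i)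
      + (\<Sum>i \<in> {1..l} - S. (D l - D (i - 1)) * (x i + t * dx i))"
      by (simp only: Ball_def Pow_iff)
  qed
  moreover have "dx k \<noteq> 0" using frac by (auto simp: dx_def)
  ultimately show ?thesis by blast
qed

section \<open>Validity of the (l, S) inequalities\<close>

text \<open>Before the first set-up outside \<open>S\<close> all production takes place in
  \<open>S\<close> and covers the demand so far; that set-up alone supplies the remaining
  \<open>D l - D (i - 1)\<close>. Without such a set-up, all production up to \<open>l\<close> lies
  in \<open>S\<close>.\<close>

lemma lot_sizing_polytope_if_integral:
  assumes D0: "D 0 = 0" and mono: "\<And>i j. i \<le> j \<Longrightarrow> j \<le> n \<Longrightarrow> D i \<le> D j"
    and xy: "\<And>i. i \<in> {1..n} \<Longrightarrow> x i \<in> {0, 1} \<and> 0 \<le> y i \<and> y i \<le> M i * x i"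
    and dem: "\<And>t. t \<in> {1..n} \<Longrightarrow> D t \<le> (\<Sum>i = 1..t. y i)"
  shows "lot_sizing_polytope n D M x y"
  unfolding lot_sizing_polytope_def
proof (intro conjI ballI allI impI)
  fix l S assume l: "l \<in> {1..n}" and S: "S \<subseteq> {1..l}"
  have S_n: "i \<in> {1..n}" if "i \<in> {1..l}" for i using that l by simp
  have finS: "finite S" using S finite_subset by blast
  have y0: "y i \<ge> 0" if "i \<in> {1..l}" for i using xy[OF S_n[OF that]] by simp
  have ge0: "(D l - D (i - 1)) * x i \<ge> 0" if "i \<in> {1..l}" for i
    using xy[OF S_n[OF that]] mono[of "i - 1" l] that l by auto
  show "D l \<le> (\<Sum>i \<in> S. y i) + (\<Sum>i \<in> {1..l} - S. (D l - D (i - 1)) * x i)"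
  proof (cases "\<exists>i. i \<in> {1..l} - S \<and> x i = 1")
    case False
    then have "y i = 0" if "i \<in> {1..l} - S" for i
      using xy[OF S_n[of i]] that by auto
    then have "(\<Sum>i \<in> S. y i) = (\<Sum>i = 1..l. y i)"
      using S by (intro sum.mono_neutral_left) auto
    moreover have "(\<Sum>i \<in> {1..l} - S. (D l - D (i - 1)) * x i) \<ge> 0"
      using ge0 by (intro sum_nonneg) auto
    ultimately show ?thesis using dem[OF l] by simp
  next
    case True
    define i where "i = (LEAST i. i \<in> {1..l} - S \<and> x i = 1)"
    have i: "i \<in> {1..l} - S" "x i = 1"
      using LeastI_ex[OF True] by (auto simp: i_def)
    have least: "x k \<noteq> 1" if "k \<in> {1..l} - S" "k < i" for k
      using not_less_Least[of k "\<lambda>i. i \<in> {1..l} - S \<and> x i = 1"] that by (auto simp: i_def)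
    have "D (i - 1) \<le> (\<Sum>k = 1..i - 1. y k)"
    proof (cases "i = 1")
      case False
      then show ?thesis using i l by (intro dem) auto
    qed (use D0 in simp)
    also have "\<dots> = (\<Sum>k \<in> S \<inter> {1..i - 1}. y k)"
    proof (intro sum.mono_neutral_right ballI)
      fix k assume k: "k \<in> {1..i - 1} - S \<inter> {1..i - 1}"
      then have "k \<in> {1..l} - S" "k < i" using i by auto
      then show "y k = 0" using least[of k] xy[OF S_n[of k]] by auto
    qed auto
    also have "\<dots> \<le> (\<Sum>k \<in> S. y k)"
      using finS S y0 by (intro sum_mono2) auto
    finally have "D (i - 1) \<le> (\<Sum>k \<in> S. y k)" .
    moreover have "D l - D (i - 1) \<le> (\<Sum>i \<in> {1..l} - S. (D l - D (i - 1)) * x i)"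
      using member_le_sum[OF i(1), of "\<lambda>i. (D l - D (i - 1)) * x i"] ge0 i(2) by auto
    ultimately show ?thesis by simp
  qed
qed (use xy in \<open>force+\<close>)

section \<open>Vector form of the polytope: convexity, compactness, extreme points\<close>

text \<open>The condition \<open>z = 0\<close> embeds the deterministic polytope in the space of the
  original points, since a zero violation budget forces \<open>z\<close> to vanish.\<close>

definition vec_polytope ::
  "(nat \<Rightarrow> 'n::finite) \<Rightarrow> (nat \<Rightarrow> real) \<Rightarrow> (nat \<Rightarrow> real) \<Rightarrow> ('n, 'm::finite) point set" where
  "vec_polytope pd D M =
     {(x, y, z). lot_sizing_polytope CARD('n) D M (\<lambda>i. x $ pd i) (\<lambda>i. y $ pd i) \<and> z = 0}"

lemma convex_vec_polytope: "convex (vec_polytope pd D M :: ('n::finite, 'm::finite) point set)"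
proof -
  have "lot_sizing_polytope n D M (\<lambda>i. u * x i + v * x' i) (\<lambda>i. u * y i + v * y' i)"
    if P: "lot_sizing_polytope n D M x y" "lot_sizing_polytope n D M x' y'"
      and uv: "0 \<le> u" "0 \<le> v" "u + v = 1" for n x y x' y' and u v :: real
    unfolding lot_sizing_polytope_def
  proof (intro conjI ballI allI impI)
    fix i assume i: "i \<in> {1..n}"
    show "0 \<le> u * x i + v * x' i" "0 \<le> u * y i + v * y' i"
      using P i uv by (auto simp: lot_sizing_polytope_def)
    show "u * x i + v * x' i \<le> 1"
      using P i uv by (intro convex_bound_le) (auto simp: lot_sizing_polytope_def)
    have "u * y i + v * y' i \<le> u * (M i * x i) + v * (M i * x' i)"
      using P i uv by (intro add_mono mult_left_mono) (auto simp: lot_sizing_polytope_def)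
    then show "u * y i + v * y' i \<le> M i * (u * x i + v * x' i)"
      by (simp add: algebra_simps)
  next
    fix l S assume l: "l \<in> {1..n}" "S \<subseteq> {1..l}"
    let ?f = "\<lambda>x y. (\<Sum>i \<in> S. y i) + (\<Sum>i \<in> {1..l} - S. (D l - D (i - 1)) * x i)"
    have "u * D l + v * D l \<le> u * ?f x y + v * ?f x' y'"
      using P l uv by (intro add_mono mult_left_mono) (auto simp: lot_sizing_polytope_def)
    also have "\<dots> = (\<Sum>i \<in> S. u * y i + v * y' i)
        + (\<Sum>i \<in> {1..l} - S. (D l - D (i - 1)) * (u * x i + v * x' i))"
      by (simp add: sum.distrib sum_distrib_left distrib_left mult_ac add_ac)
    finally show "D l \<le> (\<Sum>i \<in> S. u * y i + v * y' i)
        + (\<Sum>i \<in> {1..l} - S. (D l - D (i - 1)) * (u * x i + v * x' i))"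
      using uv by (simp add: distrib_right[symmetric])
  qed
  then show ?thesis
    by (auto simp: convex_def vec_polytope_def)
qed

lemma compact_vec_polytope:
  assumes "bij_betw pd {1..CARD('n)} UNIV"
  shows "compact (vec_polytope pd D M :: ('n::finite, 'm::finite) point set)"
proof -
  let ?n = "CARD('n)" and ?Q = "vec_polytope pd D M :: ('n, 'm) point set"
  \<comment> \<open>Upper corner of a box for \<open>y\<close>; the absolute value is taken because
    \<open>M\<close> has no assumed sign.\<close>
  define b :: "real ^ 'n" where "b = (\<chi> i. \<bar>M (inv_into {1..?n} pd i)\<bar>)"
  have pd: "\<exists>k \<in> {1..?n}. pd k = i" for i
    using bij_betw_imp_surj_on[OF assms] by (metis UNIV_I imageE)
  have b: "b $ pd k = \<bar>M k\<bar>" if "k \<in> {1..?n}" for k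
    using assms that by (simp add: b_def bij_betw_inv_into_left)
  have "?Q = (\<Inter>i \<in> {1..?n}. {p. 0 \<le> fst p $ pd i \<and> fst p $ pd i \<le> 1 \<and> 0 \<le> fst (snd p) $ pd i
        \<and> fst (snd p) $ pd i \<le> M i * fst p $ pd i})
      \<inter> (\<Inter>l \<in> {1..?n}. \<Inter>S \<in> Pow {1..l}. {p. D l \<le> (\<Sum>i \<in> S. fst (snd p) $ pd i)
        + (\<Sum>i \<in> {1..l} - S. (D l - D (i - 1)) * fst p $ pd i)}) \<inter> {p. snd (snd p) = 0}"
    unfolding vec_polytope_def lot_sizing_polytope_def by auto
  moreover have "closed \<dots>"
    by (intro closed_Int closed_INT ballI closed_Collect_conj closed_Collect_le closed_Collect_eq
        continuous_intros)
  ultimately have "closed ?Q" by metis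
  moreover have "bounded ?Q"
  proof (rule bounded_subset)
    show "bounded (cbox 0 1 \<times> cbox 0 b \<times> {0} :: ('n, 'm) point set)"
      by (intro bounded_Times) auto
    have "x \<in> cbox 0 1 \<and> y \<in> cbox 0 b"
      if P: "lot_sizing_polytope ?n D M (\<lambda>i. x $ pd i) (\<lambda>i. y $ pd i)" for x y
      unfolding mem_box_cart all_conj_distrib[symmetric]
    proof
      fix i
      obtain k where k: "k \<in> {1..?n}" "pd k = i" using pd by blast
      have "0 \<le> x $ i" "x $ i \<le> 1" "0 \<le> y $ i" "y $ i \<le> M k * x $ i"
        using P k by (auto simp: lot_sizing_polytope_def)
      moreover have "M k * x $ i \<le> \<bar>M k\<bar> * 1"
        using calculation by (intro mult_mono) auto
      ultimately show "(0 $ i \<le> x $ i \<and> x $ i \<le> 1 $ i) \<and> 0 $ i \<le> y $ i \<and> y $ i \<le> b $ i"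
        using b[OF k(1)] k(2) by simp
    qed
    then show "?Q \<subseteq> cbox 0 1 \<times> cbox 0 b \<times> {0}"
      by (auto simp: vec_polytope_def)
  qed
  ultimately show ?thesis by (simp add: compact_eq_bounded_closed)
qed

text \<open>A fractional coordinate would make the point the midpoint of two distinct points of the
  polytope, obtained by moving in both senses along the direction from
  \<open>fractional_perturbation\<close>.\<close>

lemma extreme_point_vec_polytope_integral:
  fixes pd :: "nat \<Rightarrow> 'n::finite" and x y :: "real ^ 'n" and z :: "real ^ 'm::finite"
  assumes pd: "bij_betw pd {1..CARD('n)} UNIV"
    and D0: "D 0 = 0" and mono: "\<And>i j. i \<le> j \<Longrightarrow> j \<le> CARD('n) \<Longrightarrow> D i \<le> D j"
    and M: "\<And>i. i \<in> {1..CARD('n)} \<Longrightarrow> D CARD('n) - D (i - 1) \<le> M i"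
    and ext: "(x, y, z) extreme_point_of vec_polytope pd D M"
  shows "x $ k \<in> {0, 1}"
proof (rule ccontr)
  assume nk: "x $ k \<notin> {0, 1}"
  let ?n = "CARD('n)" and ?inv = "inv_into {1..CARD('n)} pd"
  obtain i where i: "i \<in> {1..?n}" "pd i = k"
    using bij_betw_imp_surj_on[OF pd] by (metis UNIV_I imageE)
  have P: "lot_sizing_polytope ?n D M (\<lambda>i. x $ pd i) (\<lambda>i. y $ pd i)" and z: "z = 0"
    using ext by (auto simp: extreme_point_of_def vec_polytope_def)
  have "0 < x $ pd i" "x $ pd i < 1"
    using P nk i by (auto simp: lot_sizing_polytope_def order.strict_iff_order)
  from fractional_perturbation[OF P D0 mono M i(1) this]
  obtain dx dy where dx: "dx i \<noteq> 0" and ev: "\<forall>\<^sub>F t in nhds 0.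
      lot_sizing_polytope ?n D M (\<lambda>i. x $ pd i + t * dx i) (\<lambda>i. y $ pd i + t * dy i)"
    by blast
  from ev obtain \<delta> where \<delta>: "\<delta> > 0" and near: "\<And>t. \<bar>t\<bar> < \<delta> \<Longrightarrow>
      lot_sizing_polytope ?n D M (\<lambda>i. x $ pd i + t * dx i) (\<lambda>i. y $ pd i + t * dy i)"
    unfolding eventually_nhds_metric by (auto simp: dist_real_def)
  \<comment> \<open>The directions are functions of the period; the inverse of \<open>pd\<close>
    turns them into vectors.\<close>
  define p where "p t = (x + t *\<^sub>R (\<chi> i. dx (?inv i)), y + t *\<^sub>R (\<chi> i. dy (?inv i)), z)" for t
  have p_mem: "p t \<in> vec_polytope pd D M" if "\<bar>t\<bar> < \<delta>" for t
  proof -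
    have inv: "?inv (pd i) = i" if "i \<in> {1..?n}" for i
      using pd that by (rule bij_betw_inv_into_left)
    have "lot_sizing_polytope ?n D M (\<lambda>i. x $ pd i + t * dx (?inv (pd i)))
        (\<lambda>i. y $ pd i + t * dy (?inv (pd i)))"
      using near[OF that] inv by (subst lot_sizing_polytope_cong) auto
    then show ?thesis
      using z by (simp add: vec_polytope_def p_def)
  qed
  have neq: "p (\<delta> / 2) \<noteq> p (- \<delta> / 2)"
  proof
    assume "p (\<delta> / 2) = p (- \<delta> / 2)"
    then have "(fst (p (\<delta> / 2))) $ pd i = (fst (p (- \<delta> / 2))) $ pd i" by simp
    then show False
      using dx \<delta> bij_betw_inv_into_left[OF pd i(1)] by (simp add: p_def)
  qed
  moreover have "(x, y, z) = (1 - 1 / 2) *\<^sub>R p (\<delta> / 2) + (1 / 2) *\<^sub>R p (- \<delta> / 2)"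
    by (simp add: p_def vec_eq_iff field_simps)
  ultimately have "(x, y, z) \<in> open_segment (p (\<delta> / 2)) (p (- \<delta> / 2))"
    unfolding in_segment by (intro conjI exI[of _ "1 / 2"]) auto
  then show False
    using ext p_mem[of "\<delta> / 2"] p_mem[of "- \<delta> / 2"] \<delta> by (auto simp: extreme_point_of_def)
qed

text \<open>Without violations all sets \<open>T i\<close> are empty, so the choice of \<open>T\<close> and \<open>t\<close> is immaterial.\<close>

lemma mixing_ineq_no_violations:
  assumes "admissible_choice d \<sigma> 0 l S T t" "l \<in> {1..n}"
    and \<sigma>: "\<And>i. i \<in> {1..n} \<Longrightarrow> cum_demand d (\<sigma> i 1) i = D i" and D0: "D 0 = 0"
  shows "mixing_ineq pd d l S T t x y z \<longleftrightarrow>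
    D l \<le> (\<Sum>i \<in> S. y $ pd i) + (\<Sum>i \<in> {1..l} - S. (D l - D (i - 1)) * x $ pd i)"
proof -
  have T: "T (i - 1) = {} \<and> t (i - 1) 1 = \<sigma> (i - 1) 1" if "i \<in> ({1..l} - S - {1}) \<union> {l + 1}" for i
  proof -
    have "T (i - 1) \<subseteq> T_star \<sigma> 0 (i - 1)"
      and t: "t (i - 1) (card (T (i - 1)) + 1) = \<sigma> (i - 1) (0 + 1)"
      using assms(1) that unfolding admissible_choice_def by blast+
    then have "T (i - 1) = {}"
      by (simp add: T_star_def)
    then show ?thesis using t by simp
  qed
  have T0: "T 0 = {}"
    using assms(1) by (simp add: admissible_choice_def)
  have "T_bar l S T = {}"
  proof -
    have "T (i - 1) = {}" if "i \<in> {1..l} - S" for i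
      using T[of i] T0 that by (cases "i = 1") auto
    then show ?thesis
      using T[of "l + 1"] by (simp add: T_bar_def)
  qed
  moreover have "cum_demand d (t (i - 1) 1) (i - 1) = D (i - 1)" if "i \<in> {1..l} - S" for i
  proof (cases "i = 1")
    case True
    then show ?thesis using D0 by (simp add: cum_demand_def)
  next
    case False
    then have "i - 1 \<in> {1..n}" using that assms(2) by auto
    then show ?thesis using T[of i] \<sigma>[of "i - 1"] that False by simp
  qed
  moreover have "cum_demand d (t l 1) l = D l"
    using T[of "l + 1"] \<sigma>[OF assms(2)] by simp
  ultimately show ?thesis
    by (simp add: mixing_ineq_def)
qed

section \<open>The convex hull when no violation is allowed\<close>

theorem proposition4:
  fixes pd :: "nat \<Rightarrow> 'n::finite"
    and d :: "'m::finite \<Rightarrow> nat \<Rightarrow> real"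
    and \<epsilon> :: real
    and \<sigma> :: "nat \<Rightarrow> nat \<Rightarrow> 'm"
  assumes "bij_betw pd {1..CARD('n)} UNIV"
    and "\<And>j i. i \<in> {1..CARD('n)} \<Longrightarrow> d j i \<ge> 0"
    and "0 \<le> \<epsilon>" and "\<epsilon> < 1"
    and "\<And>i. i \<in> {1..CARD('n)} \<Longrightarrow> scenario_ordering d i (\<sigma> i)"
    and "\<epsilon> = 0"
  shows "convex hull (lot_sizing_set pd d \<epsilon>) =
    {(x, y, z) \<in> lp_relaxation pd d \<epsilon>.
       \<forall>l \<in> {1..CARD('n)}. \<forall>S T t. S \<subseteq> {1..l} \<longrightarrow>
         admissible_choice d \<sigma> (violations CARD('m) \<epsilon>) l S T t \<longrightarrow>
         mixing_ineq pd d l S T t x y z}"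
proof -
  define n where "n = CARD('n)"
  \<comment> \<open>Every scenario must be served, so production has to meet the largest cumulative
    demand.\<close>
  define D where "D l = (MAX j. cum_demand d j l)" for l
  define M where "M = big_M d n"
  have viol: "violations CARD('m) \<epsilon> = 0"
    using assms(6) by (simp add: violations_def)
  have D_ge: "cum_demand d j l \<le> D l" for j l
    unfolding D_def by (intro Max_ge) auto
  have D_att: "\<exists>j. D l = cum_demand d j l" for l
  proof -
    have "D l \<in> range (\<lambda>j. cum_demand d j l)"
      unfolding D_def by (intro Max_in) auto
    then show ?thesis by auto
  qed
  have D_le_iff: "D l \<le> b \<longleftrightarrow> (\<forall>j. cum_demand d j l \<le> b)" for l b
    unfolding D_def by (subst Max_le_iff) auto
  have D0: "D 0 = 0"
    using D_att[of 0] by (auto simp: cum_demand_def)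
  have mono: "D i \<le> D l" if "i \<le> l" "l \<le> n" for i l
    unfolding D_le_iff
  proof
    fix j
    have "cum_demand d j i \<le> cum_demand d j l"
      unfolding cum_demand_def using that assms(2) by (intro sum_mono2) (auto simp: n_def)
    then show "cum_demand d j i \<le> D l" using D_ge order.trans by blast
  qed
  have M: "D n - D (i - 1) \<le> M i" if i: "i \<in> {1..n}" for i
  proof -
    \<comment> \<open>For a scenario of largest total demand, the part before \<open>i\<close> is at
      most \<open>D (i - 1)\<close> and the rest is one of the sums in \<open>big_M\<close>.\<close>
    obtain j where j: "D n = cum_demand d j n" using D_att by blast
    have "{1..n} = {1..i - 1} \<union> {i..n}" using i by auto
    then have "cum_demand d j n = cum_demand d j (i - 1) + (\<Sum>p = i..n. d j p)"
      unfolding cum_demand_def by (simp add: sum.union_disjoint ivl_disj_int)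
    moreover have "(\<Sum>p = i..n. d j p) \<le> M i"
      unfolding M_def big_M_def by (intro Max_ge) auto
    ultimately show ?thesis using j D_ge[of j "i - 1"] by simp
  qed
  have \<sigma>: "cum_demand d (\<sigma> i 1) i = D i" if i: "i \<in> {1..n}" for i
  proof (rule antisym[OF D_ge])
    have so: "scenario_ordering d i (\<sigma> i)" using assms(5) i by (simp add: n_def)
    show "D i \<le> cum_demand d (\<sigma> i 1) i"
      unfolding D_le_iff
    proof
      fix j
      obtain q where "q \<in> {1..CARD('m)}" "j = \<sigma> i q"
        using so unfolding scenario_ordering_def bij_betw_def by blast
      then show "cum_demand d j i \<le> cum_demand d (\<sigma> i 1) i"
        using so by (auto simp: scenario_ordering_def)
    qed
  qed
  have pd_all: "(\<forall>i. Q i) \<longleftrightarrow> (\<forall>k \<in> {1..n}. Q (pd k))" for Q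
    using assms(1) unfolding n_def bij_betw_def by (metis UNIV_I imageE)
  have lin: "linear_constraints pd d \<epsilon> x y 0 \<longleftrightarrow>
      (\<forall>t \<in> {1..n}. D t \<le> (\<Sum>i = 1..t. y $ pd i)) \<and> (\<forall>i \<in> {1..n}. y $ pd i \<le> M i * x $ pd i)" for x y
    by (simp add: linear_constraints_def viol D_le_iff cum_demand_def M_def n_def)
  have z0: "z = 0" if "linear_constraints pd d \<epsilon> x y z" "\<And>j. z $ j \<ge> 0" for x y z
  proof -
    have "(\<Sum>j \<in> UNIV. z $ j) = 0"
      using that by (intro antisym sum_nonneg) (auto simp: linear_constraints_def viol)
    then show ?thesis
      using that(2) by (simp add: sum_nonneg_eq_0_iff vec_eq_iff)
  qed
  let ?Q = "vec_polytope pd D M :: ('n, 'm) point set"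
  have dem: "D t \<le> (\<Sum>i = 1..t. y i)" if "lot_sizing_polytope n D M x y" "t \<in> {1..n}" for x y t
  proof -
    have "D t \<le> (\<Sum>i = 1..t. y i) + (\<Sum>i \<in> {1..t} - {1..t}. (D t - D (i - 1)) * x i)"
      using that unfolding lot_sizing_polytope_def by blast
    then show ?thesis by simp
  qed
  have Q_lp: "(x, y, z) \<in> lp_relaxation pd d \<epsilon>" if "(x, y, z) \<in> ?Q" for x y z
  proof -
    have z: "z = 0" and P: "lot_sizing_polytope n D M (\<lambda>i. x $ pd i) (\<lambda>i. y $ pd i)"
      using that by (auto simp: vec_polytope_def n_def)
    have "linear_constraints pd d \<epsilon> x y 0"
      unfolding lin using dem[OF P] P by (auto simp: lot_sizing_polytope_def)
    moreover have "\<forall>i. x $ i \<in> {0..1} \<and> 0 \<le> y $ i"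
      unfolding pd_all using P by (simp add: lot_sizing_polytope_def)
    ultimately show ?thesis
      using z by (simp add: lp_relaxation_def)
  qed
  have P_eq: "lot_sizing_set pd d \<epsilon> = {(x, y, z) \<in> ?Q. \<forall>i. x $ i \<in> {0, 1}}"
  proof (intro subset_antisym subsetI; clarify)
    fix x y z assume "(x, y, z) \<in> lot_sizing_set pd d \<epsilon>"
    then have P: "\<And>i. x $ i \<in> {0, 1}" "\<And>i. y $ i \<ge> 0" "\<And>j. z $ j \<in> {0, 1}"
      "linear_constraints pd d \<epsilon> x y z"
      by (auto simp: lot_sizing_set_def)
    have z: "z = 0"
    proof (rule z0[OF P(4)])
      show "z $ j \<ge> 0" for j using P(3)[of j] by auto
    qed
    have "lot_sizing_polytope n D M (\<lambda>i. x $ pd i) (\<lambda>i. y $ pd i)"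
      using D0 mono P lin[of x y] z by (intro lot_sizing_polytope_if_integral) auto
    then show "(x, y, z) \<in> ?Q \<and> (\<forall>i. x $ i \<in> {0, 1})"
      using P(1) z by (simp add: vec_polytope_def n_def)
  next
    fix x y z assume xyz: "(x, y, z) \<in> ?Q" "\<forall>i. x $ i \<in> {0, 1}"
    then have "z = 0" by (simp add: vec_polytope_def)
    then show "(x, y, z) \<in> lot_sizing_set pd d \<epsilon>"
      using Q_lp[OF xyz(1)] xyz(2) by (simp add: lot_sizing_set_def lp_relaxation_def)
  qed
  have mix_iff: "mixing_ineq pd d l S T t x y z \<longleftrightarrow>
      D l \<le> (\<Sum>i \<in> S. y $ pd i) + (\<Sum>i \<in> {1..l} - S. (D l - D (i - 1)) * x $ pd i)"
    if "admissible_choice d \<sigma> 0 l S T t" "l \<in> {1..n}" for l S T t x y z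
    using that \<sigma> D0 by (rule mixing_ineq_no_violations)
  have "convex hull (lot_sizing_set pd d \<epsilon>) = ?Q"
  proof
    show "convex hull (lot_sizing_set pd d \<epsilon>) \<subseteq> ?Q"
      by (intro hull_minimal convex_vec_polytope) (auto simp: P_eq)
    \<comment> \<open>Krein-Milman reduces the inclusion to extreme points; their \<open>x\<close>
      is integral, so they lie in the mixed-integer set by \<open>P_eq\<close>.\<close>
    have "?Q = convex hull {p. p extreme_point_of ?Q}"
      by (intro Krein_Milman_Minkowski compact_vec_polytope convex_vec_polytope assms(1))
    also have "\<dots> \<subseteq> convex hull (lot_sizing_set pd d \<epsilon>)"
    proof (intro hull_mono subsetI; clarify)
      fix x y z assume ext: "(x, y, z) extreme_point_of ?Q"
      have "x $ k \<in> {0, 1}" for k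
        using assms(1) D0 mono M ext unfolding n_def by (rule extreme_point_vec_polytope_integral)
      then show "(x, y, z) \<in> lot_sizing_set pd d \<epsilon>"
        using ext by (simp add: P_eq extreme_point_of_def)
    qed
    finally show "?Q \<subseteq> convex hull (lot_sizing_set pd d \<epsilon>)" .
  qed
  also have "?Q = {(x, y, z) \<in> lp_relaxation pd d \<epsilon>.
       \<forall>l \<in> {1..CARD('n)}. \<forall>S T t. S \<subseteq> {1..l} \<longrightarrow>
         admissible_choice d \<sigma> (violations CARD('m) \<epsilon>) l S T t \<longrightarrow>
         mixing_ineq pd d l S T t x y z}" (is "_ = ?R")
  proof (intro subset_antisym subsetI; clarify)
    fix x y z assume xyz: "(x, y, z) \<in> ?Q"
    have "mixing_ineq pd d l S T t x y z"
      if "l \<in> {1..n}" "S \<subseteq> {1..l}" "admissible_choice d \<sigma> 0 l S T t" for l S T t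
      unfolding mix_iff[OF that(3,1)]
      using xyz that(1,2) by (simp add: vec_polytope_def lot_sizing_polytope_def n_def)
    then show "(x, y, z) \<in> lp_relaxation pd d \<epsilon> \<and> (\<forall>l \<in> {1..CARD('n)}. \<forall>S T t. S \<subseteq> {1..l} \<longrightarrow>
         admissible_choice d \<sigma> (violations CARD('m) \<epsilon>) l S T t \<longrightarrow> mixing_ineq pd d l S T t x y z)"
      using Q_lp[OF xyz] by (simp add: viol n_def)
  next
    fix x y z
    assume lp: "(x, y, z) \<in> lp_relaxation pd d \<epsilon>"
      and mix: "\<forall>l \<in> {1..CARD('n)}. \<forall>S T t. S \<subseteq> {1..l} \<longrightarrow>
         admissible_choice d \<sigma> (violations CARD('m) \<epsilon>) l S T t \<longrightarrow> mixing_ineq pd d l S T t x y z"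
    have z: "z = 0"
      using lp by (intro z0) (auto simp: lp_relaxation_def)
    have "D l \<le> (\<Sum>i \<in> S. y $ pd i) + (\<Sum>i \<in> {1..l} - S. (D l - D (i - 1)) * x $ pd i)"
      if l: "l \<in> {1..n}" and S: "S \<subseteq> {1..l}" for l S
    proof -
      \<comment> \<open>To extract the inequality for each \<open>S\<close>, some admissible choice
        is needed: empty sets, with first scenario \<open>\<sigma> i 1\<close> because
        \<open>k + 1 = 1\<close>.\<close>
      have adm: "admissible_choice d \<sigma> 0 l S (\<lambda>_. {}) (\<lambda>i _. \<sigma> i 1)"
        by (simp add: admissible_choice_def bij_betw_def)
      then have "mixing_ineq pd d l S (\<lambda>_. {}) (\<lambda>i _. \<sigma> i 1) x y z"
        using mix l S by (simp add: viol n_def)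
      then show ?thesis
        unfolding mix_iff[OF adm l] .
    qed
    then show "(x, y, z) \<in> ?Q"
      using lp z lin[of x y] by (simp add: vec_polytope_def lot_sizing_polytope_def lp_relaxation_def n_def)
  qed
  finally show ?thesis .
qed

end
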